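(* Let $S=(-1/2,1/2)\times(-1/2,1/2)\subset\mathbb{R}^2$ and let $\mathbb{P}_{K_S}$ be the determinantal point process on $\mathbb{R}^2$ with kernel $$K_S(x,y)=\frac{\sin(\pi(x_1-y_1))}{\pi(x_1-y_1)}\cdot\frac{\sin(\pi(x_2-y_2))}{\pi(x_2-y_2)},\qquad x=(x_1,x_2),\ y=(y_1,y_2)\in\mathbb{R}^2 .$$ Then $\mathbb{P}_{K_S}$ is not linearly rigid. More precisely, let $N^{(1)}=(N^{(1)}_n)_{n\in\mathbb{Z}^2}$ be the stationary stochastic process in which $N^{(1)}_n$ is the number of points of the configuration in $n+[-1/2,1/2)^2$. Then $$N^{(1)}_0\notin\check{H}_0(N^{(1)}),$$ where $\check{H}_0(N^{(1)})$ is the closed linear span in $L^2$ of $\{N^{(1)}_n: n\in\mathbb{Z}^2\setminus\{0\}\}$.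
   Context: The quotient $\sin(\pi t)/(\pi t)$ is understood to be $1$ at $t=0$. The determinantal point process $\mathbb{P}_K$ on $\mathbb{R}^d$ with kernel $K$ is the probability measure on the space of locally finite configurations of $\mathbb{R}^d$ whose $k$-point correlation functions with respect to Lebesgue measure are $\det[K(x_i,x_j)]_{1\le i,j\le k}$, $k\ge1$. Given a stationary point process on $\mathbb{R}^d$ and $\lambda>0$, define the stationary stochastic process $N^{(\lambda)}=(N^{(\lambda)}_n)_{n\in\mathbb{Z}^d}$ by letting $N^{(\lambda)}_n(\mathcal{X})$ be the cardinality of $\mathcal{X}\cap\big(n\lambda+[-\lambda/2,\lambda/2)^d\big)$, where $\mathcal{X}$ is the random configuration. The point process is called linearly rigid if for every $\lambda>0$ the random variable $N^{(\lambda)}_0$ belongs to the closed linear span in $L^2$ of $\{N^{(\lambda)}_n : n\in\mathbb{Z}^d\setminus\{0\}\}$. *)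

theory Defs
  imports "Jordan_Normal_Form.Determinant" "HOL-Probability.Probability"
begin

(* Both libraries use "$"; from here on it denotes the coordinates of a point of real^'d. *)
no_notation Matrix.vec_index (infixl "$" 100)

section \<open>Point processes and their correlation functions\<close>

definition configurations :: "'a::euclidean_space set set" where
  "configurations = {X. \<forall>B. bounded B \<longrightarrow> finite (X \<inter> B)}"

text \<open>The sigma-algebra on configurations is the one generated by the counting maps
  \<open>X \<mapsto> card (X \<inter> B)\<close>, for \<open>B\<close> a bounded Borel set.\<close>

definition config_space :: "'a::euclidean_space set measure" where
  "config_space = sigma configurations
     {{X \<in> configurations. card (X \<inter> B) = m} | B m. B \<in> sets borel \<and> bounded B}"

definition point_process :: "'a::euclidean_space set measure \<Rightarrow> bool" where
  "point_process P \<longleftrightarrow> prob_space P \<and> sets P = sets config_space"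

text \<open>A \<open>k\<close>-tuple of points is a function on \<open>{..<k}\<close> that is \<open>undefined\<close> elsewhere,
  as in the product measure \<open>PiM {..<k}\<close>.\<close>

definition distinct_tuples :: "nat \<Rightarrow> 'a set \<Rightarrow> (nat \<Rightarrow> 'a) set" where
  "distinct_tuples k X = {x \<in> {..<k} \<rightarrow>\<^sub>E X. inj_on x {..<k}}"

text \<open>For every nonnegative measurable test function \<open>f\<close>, the expectation of the sum of
  \<open>f (x\<^sub>0, \<dots>, x\<^sub>k\<^sub>-\<^sub>1)\<close> over ordered tuples of distinct points of the configuration is the integral
  of \<open>f * \<rho>\<close>. The sum is written as an integral against counting measure,
  since it may have infinitely many terms.\<close>

definition is_correlation_function ::
    "'a::euclidean_space set measure \<Rightarrow> nat \<Rightarrow> ((nat \<Rightarrow> 'a) \<Rightarrow> real) \<Rightarrow> bool" where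
  "is_correlation_function P k \<rho> \<longleftrightarrow>
     \<rho> \<in> borel_measurable (PiM {..<k} (\<lambda>_. lborel)) \<and>
     (AE x in PiM {..<k} (\<lambda>_. lborel). 0 \<le> \<rho> x) \<and>
     (\<forall>f :: (nat \<Rightarrow> 'a) \<Rightarrow> ennreal. f \<in> borel_measurable (PiM {..<k} (\<lambda>_. lborel)) \<longrightarrow>
        (\<integral>\<^sup>+X. (\<integral>\<^sup>+x. f x \<partial>count_space (distinct_tuples k X)) \<partial>P)
          = (\<integral>\<^sup>+x. f x * ennreal (\<rho> x) \<partial>PiM {..<k} (\<lambda>_. lborel)))"

definition determinantal_process ::
    "'a::euclidean_space set measure \<Rightarrow> ('a \<Rightarrow> 'a \<Rightarrow> real) \<Rightarrow> bool" where
  "determinantal_process P K \<longleftrightarrow> point_process P \<and>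
     (\<forall>k\<ge>1. is_correlation_function P k
        (\<lambda>x. Determinant.det (Matrix.mat k k (\<lambda>(i, j). K (x i) (x j)))))"

section \<open>Linear rigidity\<close>

definition box_at :: "real \<Rightarrow> int ^ 'd \<Rightarrow> (real ^ 'd) set" where
  "box_at l n = {x. \<forall>i. of_int (n $ i) * l - l / 2 \<le> x $ i \<and> x $ i < of_int (n $ i) * l + l / 2}"

definition count_process :: "real \<Rightarrow> int ^ 'd \<Rightarrow> (real ^ 'd) set \<Rightarrow> real" where
  "count_process l n X = real (card (X \<inter> box_at l n))"

definition L2_space :: "'w measure \<Rightarrow> ('w \<Rightarrow> real) set" where
  "L2_space M = {f \<in> borel_measurable M. integrable M (\<lambda>w. (f w)\<^sup>2)}"

definition linear_span :: "('w \<Rightarrow> real) set \<Rightarrow> ('w \<Rightarrow> real) set" where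
  "linear_span G = {\<lambda>w. \<Sum>g\<in>T. c g * g w | T c. finite T \<and> T \<subseteq> G}"

text \<open>The elements of \<open>L\<^sup>2\<close> are represented by functions rather than classes of
  almost everywhere equal functions. The squared \<open>L\<^sup>2\<close> distance is taken as an integral with
  values in \<open>ennreal\<close>, so that it is infinite, and not zero, if \<open>f - g\<close> is not square integrable.\<close>

definition L2_closed_linear_span :: "'w measure \<Rightarrow> ('w \<Rightarrow> real) set \<Rightarrow> ('w \<Rightarrow> real) set" where
  "L2_closed_linear_span M G = {f \<in> L2_space M.
     \<forall>\<epsilon>>0. \<exists>g\<in>linear_span G. (\<integral>\<^sup>+w. ennreal ((f w - g w)\<^sup>2) \<partial>M) < ennreal (\<epsilon>\<^sup>2)}"

definition H_check_0 :: "'w measure \<Rightarrow> (int ^ 'd \<Rightarrow> 'w \<Rightarrow> real) \<Rightarrow> ('w \<Rightarrow> real) set" where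
  "H_check_0 M N = L2_closed_linear_span M {N n | n. n \<noteq> 0}"

definition linearly_rigid :: "(real ^ 'd) set measure \<Rightarrow> bool" where
  "linearly_rigid P \<longleftrightarrow>
     (\<forall>l>0. (count_process l 0 :: (real ^ 'd) set \<Rightarrow> real) \<in> H_check_0 P (count_process l))"

section \<open>The two-dimensional sine kernel\<close>

text \<open>The library function \<open>sinc t\<close> is \<open>sin t / t\<close>, with value \<open>1\<close> at \<open>t = 0\<close>.\<close>

definition K_S :: "real ^ 2 \<Rightarrow> real ^ 2 \<Rightarrow> real" where
  "K_S x y = sinc (pi * (x $ 1 - y $ 1)) * sinc (pi * (x $ 2 - y $ 2))"

end

theory Submission
  imports Defs "HOL-Real_Asymp.Real_Asymp"
begin

text \<open>
  The variance of a finite combination \<open>\<Sum>n. c n * N n\<close> of the cell counts is a Dirichlet form.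
  Since the kernel is symmetric with diagonal \<open>1\<close>, the covariance of \<open>N n\<close> and \<open>N m\<close> is
  \<open>\<delta> n m - a n m\<close>, where \<open>a n m\<close> is the integral of the squared kernel over the product of the two
  unit cells. The numbers \<open>a n m\<close> are nonnegative and symmetric, and \<open>\<Sum>m. a n m \<le> 1\<close> because every row of the
  kernel has \<open>L\<^sup>2\<close> norm one. Hence the variance is at least
  \<open>(\<Sum>n m. a n m * (c n - c m)\<^sup>2) / 2\<close>, the energy of \<open>c\<close> for the random walk on the square lattice
  with jump rates \<open>a\<close> (\<open>second_moment_ge_dirichlet_form\<close>).

  Failure of rigidity is therefore transience of this walk: with \<open>c 0 = 1\<close>, the energy has to stay away from
  zero for all finitely supported \<open>c\<close>. The rates factor over the two coordinates and each factor
  decays no faster than an inverse square (\<open>kernel_mass_ge\<close>), so the walk makes Cauchy-like jumps along the coordinate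
  axes, and two such coordinates suffice for transience. The proof of this,
  \<open>value_at_origin_le_dirichlet_form\<close>, compares the averages of \<open>c\<close> over growing squares: passing from one
  scale to the next costs a geometrically small multiple of the square root of the energy, and the averages go
  from \<open>c 0\<close> to zero. In spectral terms, the spectral density of the counts is comparable near the origin to
  \<open>\<bar>\<theta>\<^sub>1\<bar> + \<bar>\<theta>\<^sub>2\<bar>\<close>, whose inverse is integrable in the plane; the energy estimate is an elementary substitute
  for Kolmogorov's criterion.
\<close>

section \<open>Transience of a random walk with heavy-tailed jumps along the axes\<close>

text \<open>The two averages run over \<open>I \<times> S\<close> and \<open>J \<times> S\<close>. They are compared by jumps that
  change only the first coordinate, i.e. by coupling two points with the same \<open>s\<close>; all other pairs
  of the Dirichlet form are dropped. By the Cauchy--Schwarz inequality the squared difference is at most the mean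
  of the squared jumps, and these are controlled because every jump used has weight at least \<open>1 / M\<close>.
  The embedding \<open>e\<close> decides which coordinate of the lattice is the one that jumps.\<close>

lemma average_diff_sq_le_dirichlet_form:
  fixes c :: "'a \<Rightarrow> real" and w :: "'a \<Rightarrow> 'a \<Rightarrow> real" and e :: "'i \<Rightarrow> 's \<Rightarrow> 'a"
  assumes inj: "inj (\<lambda>(i, s). e i s)"
    and fin: "finite I" "finite J" "finite S" and ne: "I \<noteq> {}" "J \<noteq> {}" "S \<noteq> {}" and IJ: "I \<subseteq> J"
    and w_nonneg: "\<And>p q. 0 \<le> w p q" and M: "0 < M"
    and w_ge: "\<And>i j s. i \<in> I \<Longrightarrow> j \<in> J \<Longrightarrow> 1 / M \<le> w (e i s) (e j s)"
    and bound: "\<And>F. finite F \<Longrightarrow> (\<Sum>p\<in>F. \<Sum>q\<in>F. w p q * (c p - c q)\<^sup>2) \<le> D"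
  shows "((\<Sum>i\<in>I. \<Sum>s\<in>S. c (e i s)) / (card I * card S) - (\<Sum>j\<in>J. \<Sum>s\<in>S. c (e j s)) / (card J * card S))\<^sup>2
           \<le> M * D / (card I * card J * card S)"
proof -
  define T where "T = I \<times> J \<times> S"
  define h where "h = (\<lambda>(i, j, s). c (e i s) - c (e j s))"
  define N where "N = real (card I * card J * card S)"
  have N: "0 < N" using fin ne by (simp add: N_def card_gt_0_iff)
  have cT: "real (card T) = N" by (simp add: T_def N_def card_cartesian_product)
  have pos: "real (card I) > 0" "real (card J) > 0" "real (card S) > 0"
    using fin ne by (simp_all add: card_gt_0_iff)
  have "sum h T = (\<Sum>i\<in>I. \<Sum>j\<in>J. \<Sum>s\<in>S. c (e i s) - c (e j s))"
    by (simp add: T_def h_def sum.cartesian_product)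
  also have "\<dots> = card J * (\<Sum>i\<in>I. \<Sum>s\<in>S. c (e i s)) - card I * (\<Sum>j\<in>J. \<Sum>s\<in>S. c (e j s))"
    by (simp add: sum_subtractf sum_distrib_left)
  finally have "(\<Sum>i\<in>I. \<Sum>s\<in>S. c (e i s)) / (card I * card S) - (\<Sum>j\<in>J. \<Sum>s\<in>S. c (e j s)) / (card J * card S)
      = sum h T / N" (is "?d = _")
    using pos by (simp add: N_def field_simps)
  then have "?d\<^sup>2 = (sum h T)\<^sup>2 / N\<^sup>2" by (simp add: power_divide)
  also have "\<dots> \<le> (\<Sum>t\<in>T. (h t)\<^sup>2) * card T / N\<^sup>2"
    by (intro divide_right_mono sum_squared_le_sum_of_squares) (auto simp: T_def fin)
  also have "\<dots> = (\<Sum>t\<in>T. (h t)\<^sup>2) / N" using N by (simp add: cT power2_eq_square)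
  also have "(\<Sum>t\<in>T. (h t)\<^sup>2) \<le> M * D"
  proof -
    define F where "F = (\<lambda>(i, s). e i s) ` (J \<times> S)"
    define g where "g = (\<lambda>(i, j, s). (e i s, e j s))"
    have inj_g: "inj_on g T" using inj by (auto simp: g_def inj_on_def)
    have "(\<Sum>t\<in>T. (h t)\<^sup>2) \<le> (\<Sum>t\<in>T. M * (case g t of (p, q) \<Rightarrow> w p q * (c p - c q)\<^sup>2))"
    proof (rule sum_mono, clarsimp simp: T_def h_def g_def)
      fix i j s assume "i \<in> I" "j \<in> J"
      then have "1 \<le> M * w (e i s) (e j s)" using w_ge[of i j s] M by (simp add: field_simps)
      from mult_right_mono[OF this, of "(c (e i s) - c (e j s))\<^sup>2"]
      show "(c (e i s) - c (e j s))\<^sup>2 \<le> M * (w (e i s) (e j s) * (c (e i s) - c (e j s))\<^sup>2)"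
        by (simp add: mult.assoc)
    qed
    also have "\<dots> = M * (\<Sum>(p, q)\<in>g ` T. w p q * (c p - c q)\<^sup>2)"
      by (simp add: sum.reindex[OF inj_g] sum_distrib_left)
    also have "(\<Sum>(p, q)\<in>g ` T. w p q * (c p - c q)\<^sup>2) \<le> (\<Sum>(p, q)\<in>F \<times> F. w p q * (c p - c q)\<^sup>2)"
      using IJ by (intro sum_mono2) (auto simp: F_def g_def T_def fin w_nonneg)
    also have "\<dots> \<le> D"
      using bound[of F] by (simp add: sum.cartesian_product F_def fin)
    finally show ?thesis using M by simp
  qed
  finally show ?thesis using N by (simp add: N_def divide_right_mono)
qed

text \<open>These are, up to a constant, lower bounds for the rates between lattice cells that come from the sine kernel.\<close>

definition jump_weight :: "int \<times> int \<Rightarrow> int \<times> int \<Rightarrow> real" where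
  "jump_weight p q = 1 / ((\<bar>of_int (fst p - fst q)\<bar> + 1)\<^sup>2 * (\<bar>of_int (snd p - snd q)\<bar> + 1)\<^sup>2)"

text \<open>This is the transience of the random walk with jump rates \<open>jump_weight\<close>: a point has
  positive capacity. Let \<open>u\<^sub>k\<close> be the average of \<open>c\<close> over the square of side \<open>4\<^sup>k\<close>.
  Enlarge the square by the factor \<open>4\<close> in one coordinate and then in the other. Along a coordinate axis
  the weight decays only like the inverse square of the jump, which gives a change of order
  \<open>sqrt (D / 4\<^sup>k)\<close> at each of the two moves. The changes are summable, whereas \<open>u\<^sub>k\<close>
  starts at \<open>c (0, 0)\<close> and tends to \<open>0\<close> because \<open>c\<close> has finite support.

  In one dimension the same weights would bound each change only by a constant times \<open>sqrt D\<close>: the gain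
  \<open>1 / 4\<^sup>k\<close> comes from the number of rows over which one averages.\<close>

lemma value_at_origin_le_dirichlet_form:
  fixes c :: "int \<times> int \<Rightarrow> real"
  assumes supp: "finite {p. c p \<noteq> 0}"
    and bound: "\<And>F. finite F \<Longrightarrow> (\<Sum>p\<in>F. \<Sum>q\<in>F. jump_weight p q * (c p - c q)\<^sup>2) \<le> D"
  shows "\<bar>c (0, 0)\<bar> \<le> 8 * sqrt D"
proof -
  (* Side 4 ^ j rather than 2 ^ j: the square roots of the estimates are then powers of 2. *)
  define I where "I j = {0..<4 ^ j :: int}" for j :: nat
  have I: "finite (I j)" "I j \<noteq> {}" "card (I j) = 4 ^ j" "I j \<subseteq> I (Suc j)" for j
    by (auto simp: I_def nat_power_eq)
  define a where "a A B = (\<Sum>i\<in>A. \<Sum>s\<in>B. c (i, s)) / (card A * card B)" for A B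
  have D: "0 \<le> D" using bound[of "{}"] by simp
  have w_nonneg: "0 \<le> jump_weight p q" for p q by (simp add: jump_weight_def)
  have close: "\<bar>i - j\<bar> + 1 \<le> 4 ^ Suc k" if "i \<in> I k" "j \<in> I (Suc k)" for i j k
    using that by (auto simp: I_def)
  have closeR: "1 / 16 ^ Suc k \<le> 1 / (\<bar>of_int i - of_int j :: real\<bar> + 1)\<^sup>2"
    if "i \<in> I k" "j \<in> I (Suc k)" for i j k
  proof -
    have "real_of_int (\<bar>i - j\<bar> + 1) \<le> real_of_int (4 ^ Suc k)"
      using close[OF that] by (subst of_int_le_iff)
    then have "(\<bar>of_int i - of_int j :: real\<bar> + 1)\<^sup>2 \<le> (4 ^ Suc k)\<^sup>2"
      by (intro power_mono) auto
    also have "\<dots> = 16 ^ Suc k" by (simp only: power_even_eq[symmetric] power_mult[symmetric] mult.commute[of _ 2]) (simp add: power_mult)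
    finally show ?thesis
      by (intro divide_left_mono) (auto intro!: mult_pos_pos zero_less_power add_nonneg_pos)
  qed
  have step1: "(a (I k) (I k) - a (I (Suc k)) (I k))\<^sup>2 \<le> 4 * D / 4 ^ k" for k
  proof -
    have "(a (I k) (I k) - a (I (Suc k)) (I k))\<^sup>2 \<le> 16 ^ Suc k * D / (card (I k) * card (I (Suc k)) * card (I k))"
      unfolding a_def
      by (rule average_diff_sq_le_dirichlet_form[where w = jump_weight and e = "\<lambda>i s. (i, s)"])
        (use I closeR[of _ k] bound in \<open>auto simp: w_nonneg inj_def jump_weight_def\<close>)
    also have "\<dots> = 4 * D / 4 ^ k"
      by (simp add: I field_simps power_mult_distrib[symmetric])
    finally show ?thesis .
  qed
  have swap: "a A B = (\<Sum>s\<in>B. \<Sum>i\<in>A. c (i, s)) / (card B * card A)" for A B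
    by (subst sum.swap) (simp add: a_def mult.commute)
  have step2: "(a (I (Suc k)) (I k) - a (I (Suc k)) (I (Suc k)))\<^sup>2 \<le> 4 * D / 4 ^ k" for k
  proof -
    have "(a (I (Suc k)) (I k) - a (I (Suc k)) (I (Suc k)))\<^sup>2 \<le> 16 ^ Suc k * D / (card (I k) * card (I (Suc k)) * card (I (Suc k)))"
      unfolding swap
      by (rule average_diff_sq_le_dirichlet_form[where w = jump_weight and e = "\<lambda>i s. (s, i)"])
        (use I closeR[of _ k] bound in \<open>auto simp: w_nonneg inj_def jump_weight_def\<close>)
    also have "\<dots> = D / 4 ^ k"
      by (simp add: I field_simps power_mult_distrib[symmetric])
    also have "\<dots> \<le> 4 * D / 4 ^ k" using D by (simp add: divide_right_mono)
    finally show ?thesis .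
  qed
  have root: "\<bar>x\<bar> \<le> 2 * sqrt D / 2 ^ k" if "x\<^sup>2 \<le> 4 * D / 4 ^ k" for x :: real and k
  proof -
    have "(2 * sqrt D / 2 ^ k)\<^sup>2 = 4 * D / 4 ^ k"
      using D by (simp add: power_divide power_mult_distrib power_mult[symmetric] mult.commute[of k]) (simp add: power_mult)
    with that show ?thesis using D by (metis abs_le_square_iff abs_of_nonneg divide_nonneg_nonneg mult_nonneg_nonneg real_sqrt_ge_zero zero_le_numeral zero_le_power)
  qed
  have tele: "\<bar>c (0, 0)\<bar> \<le> \<bar>a (I k) (I k)\<bar> + 8 * sqrt D * (1 - 1 / 2 ^ k)" for k
  proof (induction k)
    case 0
    have "I 0 = {0}" by (auto simp: I_def)
    then show ?case by (simp add: a_def)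
  next
    case (Suc k)
    from root[OF step1[of k]] root[OF step2[of k]] Suc
    have "\<bar>c (0, 0)\<bar> \<le> \<bar>a (I (Suc k)) (I (Suc k))\<bar> + 4 * sqrt D / 2 ^ k + 8 * sqrt D * (1 - 1 / 2 ^ k)"
      by linarith
    moreover have "8 * sqrt D * (1 - 1 / 2 ^ Suc k) = 4 * sqrt D / 2 ^ k + 8 * sqrt D * (1 - 1 / 2 ^ k)"
      by (simp add: field_simps)
    ultimately show ?case by linarith
  qed
  define s where "s = (\<Sum>p\<in>{p. c p \<noteq> 0}. \<bar>c p\<bar>)"
  have s: "0 \<le> s" by (simp add: s_def sum_nonneg)
  have small: "\<bar>a (I k) (I k)\<bar> \<le> s / 2 ^ k" for k
  proof -
    have "\<bar>\<Sum>i\<in>I k. \<Sum>j\<in>I k. c (i, j)\<bar> \<le> (\<Sum>p\<in>I k \<times> I k. \<bar>c p\<bar>)"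
      by (simp add: sum.cartesian_product)
    also have "\<dots> = (\<Sum>p\<in>{p \<in> I k \<times> I k. c p \<noteq> 0}. \<bar>c p\<bar>)"
      by (intro sum.mono_neutral_right) (auto simp: I)
    also have "\<dots> \<le> s" unfolding s_def by (intro sum_mono2 supp) auto
    finally have "\<bar>a (I k) (I k)\<bar> \<le> s / (4 ^ k * 4 ^ k)"
      by (simp add: a_def I abs_divide divide_right_mono)
    also have "\<dots> \<le> s / 2 ^ k"
    proof (intro divide_left_mono s)
      have "(2::real) ^ k * 1 \<le> 4 ^ k * 4 ^ k" by (intro mult_mono power_mono) auto
      then show "(2::real) ^ k \<le> 4 ^ k * 4 ^ k" by simp
    qed simp
    finally show ?thesis .
  qed
  have "\<bar>c (0, 0)\<bar> \<le> 8 * sqrt D + s / 2 ^ k" for k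
  proof -
    have "8 * sqrt D * (1 - 1 / 2 ^ k) \<le> 8 * sqrt D" using D by (simp add: field_simps)
    then show ?thesis using tele[of k] small[of k] by linarith
  qed
  moreover have "(\<lambda>k. 8 * sqrt D + s / 2 ^ k) \<longlonglongrightarrow> 8 * sqrt D + 0"
    by (intro tendsto_intros) (simp add: LIMSEQ_divide_realpow_zero)
  ultimately show ?thesis by (intro LIMSEQ_le_const[of "\<lambda>k. 8 * sqrt D + s / 2 ^ k"]) auto
qed

section \<open>The sine kernel\<close>

text \<open>Integration by parts reduces this to the sine integral: \<open>Si (2 * T) - (sin T)\<^sup>2 / T\<close> is a
  primitive of \<open>(sinc T)\<^sup>2\<close> and tends to \<open>pi / 2\<close>.\<close>

lemma nn_integral_sinc_sq: "(\<integral>\<^sup>+t. ennreal ((sinc t)\<^sup>2) \<partial>lborel) = ennreal pi"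
proof -
  define F where "F T = Si (2 * T) - sin T * sinc T" for T
  have der: "(F has_real_derivative (sinc T)\<^sup>2) (at T)" for T
  proof (cases "T = 0")
    case False
    have ev: "\<forall>\<^sub>F x in nhds T. F x = Si (2 * x) - sin x * (sin x / x)"
      using eventually_nhds_in_open[of "- {0}" T] False by (auto elim!: eventually_mono simp: F_def)
    have double: "sin (T * 2) = cos T * (sin T * 2)"
      using sin_double[of T] by (simp add: mult_ac)
    have "((\<lambda>x. Si (2 * x) - sin x * (sin x / x)) has_real_derivative (sinc T)\<^sup>2) (at T)"
      using False
      by (auto intro!: derivative_eq_intros DERIV_chain2[OF DERIV_Si] simp: double field_simps power2_eq_square)
    then show ?thesis using DERIV_cong_ev[OF refl ev refl] by blast
  next
    case True
    have c: "(sinc \<longlongrightarrow> 1) (at 0)" using isCont_sinc[of 0] by (simp add: isCont_def)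
    have L: "((\<lambda>h. sinc h * sinc h) \<longlongrightarrow> 1) (at 0)" using tendsto_mult[OF c c] by simp
    have "((\<lambda>h. (sin (0 + h) * sinc (0 + h) - sin 0 * sinc 0) / h) \<longlongrightarrow> 1) (at 0)"
      by (rule Lim_transform_eventually[OF L]) (auto simp: eventually_at_filter)
    then have "((\<lambda>x. sin x * sinc x) has_real_derivative 1) (at 0)"
      unfolding DERIV_def by auto
    moreover have "((\<lambda>x. Si (2 * x)) has_real_derivative sinc (2 * 0) * 2) (at 0)"
      by (rule DERIV_chain2[OF DERIV_Si]) (auto intro!: derivative_eq_intros)
    then have "((\<lambda>x. Si (2 * x)) has_real_derivative 2) (at 0)" by simp
    ultimately have "((\<lambda>x. Si (2 * x) - sin x * sinc x) has_real_derivative 2 - 1) (at 0)"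
      by (rule DERIV_diff[rotated])
    then show ?thesis using True by (simp add: F_def[abs_def])
  qed
  have lim: "(F \<longlongrightarrow> pi / 2) at_top"
  proof -
    have "((\<lambda>x. Si (2 * x)) \<longlongrightarrow> pi / 2) at_top"
      by (rule filterlim_compose[OF Si_at_top]) real_asymp
    moreover have "((\<lambda>T. sin T * sinc T) \<longlongrightarrow> 0) at_top"
    proof (rule Lim_null_comparison)
      show "\<forall>\<^sub>F T in at_top. norm (sin T * sinc T) \<le> 1 / T"
        using eventually_gt_at_top[of 0]
      proof eventually_elim
        case (elim T)
        have "\<bar>sin T\<bar> * \<bar>sin T\<bar> \<le> 1 * 1" by (intro mult_mono) auto
        then show ?case using elim by (simp add: abs_mult field_simps)
      qed
      show "((\<lambda>T::real. 1 / T) \<longlongrightarrow> 0) at_top" by real_asymp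
    qed
    ultimately show ?thesis unfolding F_def using tendsto_diff by fastforce
  qed
  have meas: "(\<lambda>t. (sinc t)\<^sup>2) \<in> borel_measurable borel" by measurable
  have half: "(\<integral>\<^sup>+t. ennreal ((sinc t)\<^sup>2) * indicator {0..} t \<partial>lborel) = ennreal (pi / 2)"
    using nn_integral_FTC_atLeast[OF meas, of 0 F "pi / 2"] der lim Si_neg[of 0] by (simp add: F_def)
  have half': "(\<integral>\<^sup>+t. ennreal ((sinc t)\<^sup>2) * indicator {..0} t \<partial>lborel) = ennreal (pi / 2)"
  proof -
    have "(\<integral>\<^sup>+t. ennreal ((sinc t)\<^sup>2) * indicator {..0} t \<partial>lborel)
        = ennreal \<bar>-1\<bar> * (\<integral>\<^sup>+t. ennreal ((sinc (0 + (-1) * t))\<^sup>2) * indicator {..0} (0 + (-1) * t :: real) \<partial>lborel)"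
      by (rule nn_integral_real_affine) auto
    also have "\<dots> = (\<integral>\<^sup>+t. ennreal ((sinc t)\<^sup>2) * indicator {0..} t \<partial>lborel)"
      by (auto intro!: nn_integral_cong split: split_indicator)
    finally show ?thesis by (simp only: half)
  qed
  have "(\<integral>\<^sup>+t. ennreal ((sinc t)\<^sup>2) \<partial>lborel)
      = (\<integral>\<^sup>+t. ennreal ((sinc t)\<^sup>2) * indicator {0..} t + ennreal ((sinc t)\<^sup>2) * indicator {..0} t \<partial>lborel)"
    by (rule nn_integral_cong_AE) (use AE_lborel_singleton[of 0] in \<open>auto elim!: eventually_mono split: split_indicator\<close>)
  also have "\<dots> = ennreal (pi / 2) + ennreal (pi / 2)"
    by (subst nn_integral_add) (auto simp only: half half', measurable)
  also have "\<dots> = ennreal pi" by (subst ennreal_plus[symmetric]) auto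
  finally show ?thesis .
qed

lemma sinc_sq_le_1: "(sinc t)\<^sup>2 \<le> 1"
proof -
  have "\<bar>sin t\<bar> \<le> \<bar>t\<bar>" by (rule abs_sin_x_le_abs_x)
  then have "\<bar>sinc t\<bar> \<le> 1" by (auto simp: field_simps)
  then show ?thesis by (simp add: abs_square_le_1)
qed

lemma K_S_sq: "(K_S x y)\<^sup>2 = (\<Prod>b\<in>Basis. (sinc (pi * inner (x - y) b))\<^sup>2)"
proof -
  have B: "Basis = {axis 1 1, axis 2 1 :: real ^ 2}"
    by (auto simp: Basis_vec_def UNIV_2)
  have ne: "axis 1 1 \<noteq> (axis 2 1 :: real ^ 2)" by (simp add: axis_eq_axis)
  show ?thesis unfolding B using ne
    by (simp add: K_S_def inner_axis power_mult_distrib)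
qed

lemma measurable_K_S [measurable]: "(\<lambda>(x, y). K_S x y) \<in> borel_measurable (borel \<Otimes>\<^sub>M borel)"
proof -
  have [measurable]: "(\<lambda>x :: real ^ 2. x $ i) \<in> borel_measurable borel" for i
    by (intro borel_measurable_continuous_onI continuous_intros)
  show ?thesis unfolding K_S_def case_prod_beta by measurable
qed

lemma K_S_sym: "K_S x y = K_S y x"
proof -
  have "sinc (pi * (x $ i - y $ i)) = sinc (pi * (y $ i - x $ i))" for i
    using sinc_neg[of "pi * (x $ i - y $ i)"] by (simp only: minus_mult_right minus_diff_eq)
  from this[of 1] this[of 2] show ?thesis
    unfolding K_S_def by (rule arg_cong2[where f = "(*)"])
qed

lemma K_S_diag: "K_S x x = 1" by (simp add: K_S_def)

lemma K_S_sq_le_1: "(K_S x y)\<^sup>2 \<le> 1"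
  unfolding K_S_sq by (intro prod_le_1 conjI zero_le_power2 sinc_sq_le_1)

text \<open>The kernel is an orthogonal projection with diagonal value \<open>1\<close>, so its rows are unit vectors
  of \<open>L\<^sup>2\<close>. This identity makes the overlaps of one cell with all the cells add up to at most one.\<close>

lemma nn_integral_K_S_sq: "(\<integral>\<^sup>+y. ennreal ((K_S x y)\<^sup>2) \<partial>lborel) = 1"
proof -
  have one: "(\<integral>\<^sup>+t. ennreal ((sinc (pi * (a - t)))\<^sup>2) \<partial>lborel) = 1" for a :: real
  proof -
    have "ennreal pi = ennreal \<bar>- pi\<bar> * (\<integral>\<^sup>+t. ennreal ((sinc (pi * a + (- pi) * t))\<^sup>2) \<partial>lborel)"
      unfolding nn_integral_sinc_sq[symmetric] by (rule nn_integral_real_affine) auto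
    also have "\<dots> = ennreal pi * (\<integral>\<^sup>+t. ennreal ((sinc (pi * (a - t)))\<^sup>2) \<partial>lborel)"
      by (simp only: mult_minus_left right_diff_distrib abs_minus_cancel abs_of_pos[OF pi_gt_zero] add_uminus_conv_diff)
    finally have "ennreal pi * 1 = ennreal pi * (\<integral>\<^sup>+t. ennreal ((sinc (pi * (a - t)))\<^sup>2) \<partial>lborel)" by simp
    then show ?thesis by (subst (asm) ennreal_mult_cancel_left) auto
  qed
  have "(\<integral>\<^sup>+y. ennreal ((K_S x y)\<^sup>2) \<partial>lborel)
     = (\<integral>\<^sup>+y. (\<Prod>b\<in>Basis. ennreal ((sinc (pi * (inner x b - inner y b)))\<^sup>2)) \<partial>lborel)"
    by (simp only: K_S_sq inner_diff_left) (simp add: prod_ennreal)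
  also have "\<dots> = (\<Prod>b\<in>(Basis :: (real ^ 2) set). \<integral>\<^sup>+t. ennreal ((sinc (pi * (inner x b - t)))\<^sup>2) \<partial>lborel)"
    by (rule nn_integral_lborel_prod) auto
  also have "\<dots> = 1" by (simp only: one prod.neutral_const)
  finally show ?thesis .
qed

section \<open>The squared kernel on pairs of unit cells\<close>

definition kernel_mass :: "(real ^ 2) set \<Rightarrow> (real ^ 2) set \<Rightarrow> ennreal" where
  "kernel_mass A B = (\<integral>\<^sup>+x. (\<integral>\<^sup>+y. indicator A x * indicator B y * ennreal ((K_S x y)\<^sup>2) \<partial>lborel) \<partial>lborel)"

lemma kernel_mass_sym:
  assumes [measurable]: "A \<in> sets borel" "B \<in> sets borel"
  shows "kernel_mass A B = kernel_mass B A"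
proof -
  have "kernel_mass A B = (\<integral>\<^sup>+y. (\<integral>\<^sup>+x. indicator A x * indicator B y * ennreal ((K_S x y)\<^sup>2) \<partial>lborel) \<partial>lborel)"
    unfolding kernel_mass_def by (rule lborel_pair.Fubini') measurable
  also have "\<dots> = kernel_mass B A"
    by (simp add: kernel_mass_def K_S_sym mult_ac)
  finally show ?thesis .
qed

text \<open>For \<open>t\<close> in the middle half of the unit interval, \<open>sin (pi * (k - t))\<close> stays away from zero for
  every integer \<open>k\<close>, so the square decays no faster than the inverse square of \<open>k\<close>.\<close>

lemma sinc_sq_ge:
  fixes k :: int and t :: real
  assumes "1 / 4 \<le> t" "t \<le> 3 / 4"
  shows "1 / (2 * pi\<^sup>2 * (\<bar>of_int k\<bar> + 1)\<^sup>2) \<le> (sinc (pi * (of_int k - t)))\<^sup>2"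
proof -
  have ne: "of_int k \<noteq> t"
  proof
    assume "of_int k = t"
    then have "0 < real_of_int k" "real_of_int k < 1" using assms by auto
    then show False by simp
  qed
  have "cos (2 * (pi * (of_int k - t))) = cos (2 * pi * t)"
  proof -
    have "2 * (pi * (of_int k - t)) = 2 * pi * of_int k - 2 * pi * t" by (simp add: algebra_simps)
    then show ?thesis by (simp add: cos_diff)
  qed
  also have "\<dots> = - cos (2 * pi * t - pi)" by (simp add: cos_diff)
  also have "\<dots> \<le> 0"
  proof -
    have "pi * (1 / 4) \<le> pi * t" "pi * t \<le> pi * (3 / 4)" using assms by (intro mult_left_mono; simp)+
    then have "- (pi / 2) \<le> 2 * (pi * t) - pi" "2 * (pi * t) - pi \<le> pi / 2" by linarith+
    then have "0 \<le> cos (2 * (pi * t) - pi)" by (rule cos_ge_zero)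
    then show ?thesis by (simp add: mult.assoc)
  qed
  finally have sin: "1 / 2 \<le> (sin (pi * (of_int k - t)))\<^sup>2"
    by (simp add: cos_double_sin)
  have "(of_int k - t)\<^sup>2 \<le> (\<bar>of_int k\<bar> + 1)\<^sup>2"
    using assms by (subst abs_le_square_iff[symmetric]) auto
  moreover have "0 < (of_int k - t)\<^sup>2" using ne by simp
  ultimately have "1 / (2 * pi\<^sup>2 * (\<bar>of_int k\<bar> + 1)\<^sup>2) \<le> 1 / (2 * pi\<^sup>2 * (of_int k - t)\<^sup>2)"
    by (intro divide_left_mono mult_left_mono mult_pos_pos) auto
  also have "\<dots> = (1 / 2) / (pi * (of_int k - t))\<^sup>2" by (simp add: power_mult_distrib)
  also have "\<dots> \<le> (sin (pi * (of_int k - t)))\<^sup>2 / (pi * (of_int k - t))\<^sup>2"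
    by (intro divide_right_mono sin) auto
  also have "\<dots> = (sinc (pi * (of_int k - t)))\<^sup>2" using ne by (simp add: power_divide)
  finally show ?thesis .
qed

lemma emeasure_square:
  fixes a :: "real ^ 2"
  assumes "0 \<le> r"
  shows "emeasure lborel (box a (\<chi> i. a $ i + r)) = ennreal (r\<^sup>2)"
    and "emeasure lborel (cbox a (\<chi> i. a $ i + r)) = ennreal (r\<^sup>2)"
proof -
  have d: "(\<chi> i. a $ i + r) - a = (\<chi> i. r)" by (simp add: Finite_Cartesian_Product.vec_eq_iff)
  have "inner (\<chi> i. r) b = r" if "b \<in> Basis" for b :: "real ^ 2"
    using that by (auto simp: Basis_vec_def inner_axis)
  then have "(\<Prod>b\<in>Basis. inner ((\<chi> i. a $ i + r) - a) b) = (\<Prod>b\<in>(Basis :: (real ^ 2) set). r)"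
    unfolding d by (intro prod.cong) auto
  then have p: "(\<Prod>b\<in>Basis. inner ((\<chi> i. a $ i + r) - a) b) = r\<^sup>2" by simp
  have le: "inner a b \<le> inner (\<chi> i. a $ i + r) b" if "b \<in> Basis" for b
    using that assms by (auto simp: Basis_vec_def inner_axis)
  show "emeasure lborel (box a (\<chi> i. a $ i + r)) = ennreal (r\<^sup>2)"
    using p le by (subst emeasure_lborel_box) auto
  show "emeasure lborel (cbox a (\<chi> i. a $ i + r)) = ennreal (r\<^sup>2)"
    using p le by (subst emeasure_lborel_cbox) auto
qed

lemma box_at_borel [measurable]: "box_at l n \<in> sets borel"
proof -
  have [measurable]: "(\<lambda>x :: real ^ 'd. x $ i) \<in> borel_measurable borel" for i
    by (intro borel_measurable_continuous_onI continuous_intros)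
  have "{x \<in> space borel. \<forall>i. of_int (n $ i) * l - l / 2 \<le> x $ i \<and> x $ i < of_int (n $ i) * l + l / 2} \<in> sets borel"
    by measurable
  then show ?thesis by (simp add: box_at_def)
qed

lemma box_at_subset_cbox:
  "box_at l n \<subseteq> cbox (\<chi> i. of_int (n $ i) * l - l / 2) (\<chi> i. of_int (n $ i) * l + l / 2)"
  by (auto simp: box_at_def mem_box_cart less_imp_le)

lemma bounded_box_at: "bounded (box_at l n)"
  by (rule bounded_subset[OF bounded_cbox box_at_subset_cbox])

lemma emeasure_box_at:
  fixes n :: "int ^ 2"
  shows "emeasure lborel (box_at 1 n) = 1"
proof (rule antisym)
  define a :: "real ^ 2" where "a = (\<chi> i. of_int (n $ i) * 1 - 1 / 2)"
  have b: "(\<chi> i. of_int (n $ i) * 1 + 1 / 2) = (\<chi> i. a $ i + 1)" by (simp add: a_def Finite_Cartesian_Product.vec_eq_iff)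
  have "emeasure lborel (box_at 1 n) \<le> emeasure lborel (cbox a (\<chi> i. a $ i + 1))"
    using box_at_subset_cbox[of 1 n] by (intro emeasure_mono) (simp_all only: b a_def[symmetric] sets_lborel cbox_borel)
  then show "emeasure lborel (box_at 1 n) \<le> 1" by (simp add: emeasure_square)
  have "box a (\<chi> i. a $ i + 1) \<subseteq> box_at 1 n"
  proof
    fix x assume x: "x \<in> box a (\<chi> i. a $ i + 1)"
    have "of_int (n $ i) - 1 / 2 \<le> x $ i \<and> x $ i < of_int (n $ i) + 1 / 2" for i
      using x[unfolded a_def mem_box_cart, THEN spec, of i] by auto
    then show "x \<in> box_at 1 n" by (simp add: box_at_def)
  qed
  from emeasure_mono[OF this, of lborel] show "1 \<le> emeasure lborel (box_at 1 n)"
    by (simp add: emeasure_square)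
qed

lemma box_at_disjoint: "x \<in> box_at 1 n \<Longrightarrow> x \<in> box_at 1 m \<Longrightarrow> n = m"
proof -
  assume x: "x \<in> box_at 1 n" "x \<in> box_at 1 m"
  have "n $ i = m $ i" for i
  proof -
    have "\<bar>real_of_int (n $ i) - real_of_int (m $ i)\<bar> < 1"
      using x by (auto simp: box_at_def dest!: spec[of _ i])
    then show ?thesis by linarith
  qed
  then show "n = m" by (simp add: Finite_Cartesian_Product.vec_eq_iff)
qed

lemma sum_kernel_mass_le:
  fixes n :: "int ^ 2"
  assumes "finite F"
  shows "(\<Sum>m\<in>F. kernel_mass (box_at 1 n) (box_at 1 m)) \<le> 1"
proof -
  have "(\<Sum>m\<in>F. kernel_mass (box_at 1 n) (box_at 1 m))
      = (\<integral>\<^sup>+x. (\<integral>\<^sup>+y. (\<Sum>m\<in>F. indicator (box_at 1 n) x * indicator (box_at 1 m) y * ennreal ((K_S x y)\<^sup>2)) \<partial>lborel) \<partial>lborel)"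
    unfolding kernel_mass_def by (subst nn_integral_sum[symmetric], measurable)+
  also have "\<dots> \<le> (\<integral>\<^sup>+x. (\<integral>\<^sup>+y. indicator (box_at 1 n) x * ennreal ((K_S x y)\<^sup>2) \<partial>lborel) \<partial>lborel)"
  proof (intro nn_integral_mono)
    fix x y :: "real ^ 2"
    have "(\<Sum>m\<in>F. indicator (box_at 1 m) y :: ennreal) \<le> 1"
    proof (cases "\<exists>m\<in>F. y \<in> box_at 1 m")
      case True
      then obtain m where m: "m \<in> F" "y \<in> box_at 1 m" by blast
      have "(\<Sum>k\<in>F. indicator (box_at 1 k) y :: ennreal) = (\<Sum>k\<in>F. if k = m then 1 else 0)"
        using m by (intro sum.cong) (auto simp: indicator_def dest: box_at_disjoint)
      then show ?thesis using m assms by simp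
    next
      case False
      then have "(\<Sum>m\<in>F. indicator (box_at 1 m) y :: ennreal) = 0"
        by (intro sum.neutral) (auto simp: indicator_def)
      then show ?thesis by simp
    qed
    then have "indicator (box_at 1 n) x * ennreal ((K_S x y)\<^sup>2) * (\<Sum>m\<in>F. indicator (box_at 1 m) y)
       \<le> indicator (box_at 1 n) x * ennreal ((K_S x y)\<^sup>2) * 1"
      by (rule mult_left_mono) auto
    then show "(\<Sum>m\<in>F. indicator (box_at 1 n) x * indicator (box_at 1 m) y * ennreal ((K_S x y)\<^sup>2))
       \<le> indicator (box_at 1 n) x * ennreal ((K_S x y)\<^sup>2)"
      by (simp add: sum_distrib_left mult_ac)
  qed
  also have "\<dots> = (\<integral>\<^sup>+x. indicator (box_at 1 n) x \<partial>lborel)"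
    by (simp add: nn_integral_cmult nn_integral_K_S_sq)
  also have "\<dots> = 1" by (simp add: emeasure_box_at)
  finally show ?thesis by simp
qed

text \<open>Restrict the integral to \<open>x\<close> in \<open>n + (-1/4, 0)\<^sup>2\<close> and \<open>y\<close> in \<open>m + (1/4, 1/2)\<^sup>2\<close>, two squares of
  area \<open>1/16\<close>. There each coordinate of \<open>x - y\<close> is an integer minus a number in the middle half of
  the unit interval, and both factors of the kernel are bounded below.\<close>

lemma kernel_mass_ge:
  fixes n m :: "int ^ 2"
  shows "ennreal (1 / (1024 * pi ^ 4) / ((\<bar>of_int (n $ 1 - m $ 1)\<bar> + 1)\<^sup>2 * (\<bar>of_int (n $ 2 - m $ 2)\<bar> + 1)\<^sup>2))
    \<le> kernel_mass (box_at 1 n) (box_at 1 m)"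
proof -
  define a :: "real ^ 2" where "a = (\<chi> i. of_int (n $ i) - 1 / 4)"
  define b :: "real ^ 2" where "b = (\<chi> i. of_int (m $ i) + 1 / 4)"
  define A where "A = box a (\<chi> i. a $ i + 1 / 4)"
  define B where "B = box b (\<chi> i. b $ i + 1 / 4)"
  have AB: "A \<subseteq> box_at 1 n" "B \<subseteq> box_at 1 m"
  proof -
    have "x \<in> box_at 1 n" if "x \<in> A" for x
    proof -
      have "of_int (n $ i) - 1 / 2 \<le> x $ i \<and> x $ i < of_int (n $ i) + 1 / 2" for i
        using that[unfolded A_def a_def mem_box_cart, THEN spec, of i] by auto
      then show ?thesis by (simp add: box_at_def)
    qed
    moreover have "x \<in> box_at 1 m" if "x \<in> B" for x
    proof -
      have "of_int (m $ i) - 1 / 2 \<le> x $ i \<and> x $ i < of_int (m $ i) + 1 / 2" for i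
        using that[unfolded B_def b_def mem_box_cart, THEN spec, of i] by auto
      then show ?thesis by (simp add: box_at_def)
    qed
    ultimately show "A \<subseteq> box_at 1 n" "B \<subseteq> box_at 1 m" by blast+
  qed
  have [measurable]: "A \<in> sets borel" "B \<in> sets borel" by (auto simp: A_def B_def)
  define \<kappa> where "\<kappa> = (\<Prod>i\<in>{1, 2 :: 2}. 1 / (2 * pi\<^sup>2 * (\<bar>of_int (n $ i - m $ i)\<bar> + 1)\<^sup>2) :: real)"
  have \<kappa>: "0 \<le> \<kappa>" by (simp add: \<kappa>_def)
  have K: "\<kappa> \<le> (K_S x y)\<^sup>2" if x: "x \<in> A" and y: "y \<in> B" for x y
  proof -
    have "1 / (2 * pi\<^sup>2 * (\<bar>of_int (n $ i - m $ i)\<bar> + 1)\<^sup>2) \<le> (sinc (pi * (x $ i - y $ i)))\<^sup>2" for i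
    proof -
      define t where "t = of_int (n $ i - m $ i) - (x $ i - y $ i)"
      have "1 / 4 \<le> t" "t \<le> 3 / 4"
        using x[unfolded A_def a_def mem_box_cart] y[unfolded B_def b_def mem_box_cart]
        by (auto simp: t_def dest!: spec[of _ i])
      moreover have eq: "of_int (n $ i - m $ i) - t = x $ i - y $ i" by (simp add: t_def)
      ultimately show ?thesis using sinc_sq_ge[of t "n $ i - m $ i"] by (simp only: eq)
    qed
    then have "\<kappa> \<le> (\<Prod>i\<in>{1, 2 :: 2}. (sinc (pi * (x $ i - y $ i)))\<^sup>2)"
      unfolding \<kappa>_def by (intro prod_mono conjI) auto
    also have "\<dots> = (K_S x y)\<^sup>2"
      unfolding K_S_def power_mult_distrib by simp
    finally show ?thesis .
  qed
  have "ennreal (1 / (1024 * pi ^ 4) / ((\<bar>of_int (n $ 1 - m $ 1)\<bar> + 1)\<^sup>2 * (\<bar>of_int (n $ 2 - m $ 2)\<bar> + 1)\<^sup>2))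
      = ennreal (\<kappa> * (1 / 4)\<^sup>2 * (1 / 4)\<^sup>2)"
    by (rule arg_cong[of _ _ ennreal]) (simp add: \<kappa>_def power2_eq_square field_simps power4_eq_xxxx)
  also have "\<dots> = (\<integral>\<^sup>+x. (\<integral>\<^sup>+y. indicator A x * indicator B y * ennreal \<kappa> \<partial>lborel) \<partial>lborel)"
  proof -
    have "emeasure lborel A = ennreal ((1 / 4)\<^sup>2)" "emeasure lborel B = ennreal ((1 / 4)\<^sup>2)"
      unfolding A_def B_def by (rule emeasure_square; simp)+
    moreover have "ennreal (\<kappa> * (1 / 4)\<^sup>2 * (1 / 4)\<^sup>2) = ennreal \<kappa> * ennreal ((1 / 4)\<^sup>2) * ennreal ((1 / 4)\<^sup>2)"
      using \<kappa> by (simp only: ennreal_mult zero_le_power2 mult_nonneg_nonneg)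
    ultimately have "ennreal (\<kappa> * (1 / 4)\<^sup>2 * (1 / 4)\<^sup>2) = emeasure lborel A * (emeasure lborel B * ennreal \<kappa>)"
      by (simp only: mult_ac)
    also have "\<dots> = (\<integral>\<^sup>+x. (\<integral>\<^sup>+y. indicator A x * indicator B y * ennreal \<kappa> \<partial>lborel) \<partial>lborel)"
      by (simp add: nn_integral_multc nn_integral_cmult mult.assoc)
    finally show ?thesis .
  qed
  also have "\<dots> \<le> kernel_mass (box_at 1 n) (box_at 1 m)"
    unfolding kernel_mass_def
  proof (intro nn_integral_mono)
    fix x y show "indicator A x * indicator B y * ennreal \<kappa>
      \<le> indicator (box_at 1 n) x * indicator (box_at 1 m) y * ennreal ((K_S x y)\<^sup>2)"
      using AB K[of x y] by (auto simp: indicator_def intro!: ennreal_leI)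
  qed
  finally show ?thesis .
qed

text \<open>The family is symmetric with row sums at most one, and is used as the jump rates of a random walk on the
  cells.\<close>

definition overlap :: "int ^ 2 \<Rightarrow> int ^ 2 \<Rightarrow> real" where
  "overlap n m = enn2real (kernel_mass (box_at 1 n) (box_at 1 m))"

lemma kernel_mass_eq_overlap: "kernel_mass (box_at 1 n) (box_at 1 m) = ennreal (overlap n m)"
proof -
  have "kernel_mass (box_at 1 n) (box_at 1 m) \<le> 1"
    using sum_kernel_mass_le[of "{m}" n] by simp
  then have "kernel_mass (box_at 1 n) (box_at 1 m) < \<infinity>"
    by (rule le_less_trans) simp
  then show ?thesis by (simp add: overlap_def)
qed

lemma overlap_nonneg: "0 \<le> overlap n m" by (simp add: overlap_def)

lemma overlap_sym: "overlap n m = overlap m n"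
  unfolding overlap_def by (subst kernel_mass_sym) auto

lemma sum_overlap_le: "finite F \<Longrightarrow> (\<Sum>m\<in>F. overlap n m) \<le> 1"
proof -
  assume "finite F"
  then have "(\<Sum>m\<in>F. kernel_mass (box_at 1 n) (box_at 1 m)) \<le> 1" by (rule sum_kernel_mass_le)
  then have "ennreal (\<Sum>m\<in>F. overlap n m) \<le> ennreal 1"
    by (simp add: kernel_mass_eq_overlap sum_ennreal overlap_nonneg)
  then show ?thesis by (subst (asm) ennreal_le_iff) auto
qed

definition lattice_point :: "int \<times> int \<Rightarrow> int ^ 2" where
  "lattice_point p = (\<chi> i. if i = 1 then fst p else snd p)"

lemma inj_lattice_point: "inj lattice_point"
  by (rule inj_on_inverseI[where g = "\<lambda>n. (n $ 1, n $ 2)"]) (simp add: lattice_point_def)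

lemma overlap_ge_jump_weight:
  "jump_weight p q / (1024 * pi ^ 4) \<le> overlap (lattice_point p) (lattice_point q)"
proof -
  have "ennreal (jump_weight p q / (1024 * pi ^ 4)) \<le> ennreal (overlap (lattice_point p) (lattice_point q))"
    using kernel_mass_ge[of "lattice_point p" "lattice_point q"]
    by (simp add: kernel_mass_eq_overlap lattice_point_def jump_weight_def field_simps)
  then show ?thesis by (simp add: overlap_nonneg)
qed

section \<open>First and second moments of a determinantal process\<close>

lemma det_mat_1: "Determinant.det (Matrix.mat 1 1 f) = f (0, 0)"
  by (simp add: Determinant.det_def permutes_sing atLeast0_lessThan_Suc lessThan_Suc)

lemma det_mat_2: "Determinant.det (Matrix.mat 2 2 f) = f (0, 0) * f (1, 1) - f (0, 1) * f (1, 0)"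
proof -
  have 2: "{0..<2 :: nat} = {0, 1}" by auto
  have "finite {1 :: nat}" "(0 :: nat) \<notin> {1}" by auto
  then show ?thesis
    by (simp add: Determinant.det_def 2 sum_over_permutations_insert permutes_sing sign_swap_id sign_id
        Transposition.transpose_def)
qed

lemma measurable_card_Int:
  assumes P: "point_process P" and B: "B \<in> sets borel" "bounded B"
  shows "(\<lambda>X. card (X \<inter> B)) \<in> measurable P (count_space UNIV)"
proof -
  have sub: "{{X \<in> configurations. card (X \<inter> B) = m} | B m. B \<in> sets borel \<and> bounded B} \<subseteq> Pow (configurations :: 'a set set)"
    by auto
  have sets: "sets P = sets config_space" using P by (simp add: point_process_def)
  then have space: "space P = configurations"
    using sets_eq_imp_space_eq[OF sets] sub by (simp add: config_space_def space_measure_of)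
  have "(\<lambda>X. card (X \<inter> B)) -` {m} \<inter> space P \<in> sets P" for m
  proof -
    have "(\<lambda>X. card (X \<inter> B)) -` {m} \<inter> space P = {X \<in> configurations. card (X \<inter> B) = m}"
      by (auto simp: space)
    also have "\<dots> \<in> sets P"
      unfolding sets config_space_def using sub B by (subst sets_measure_of) auto
    finally show ?thesis .
  qed
  then show ?thesis by (subst measurable_count_space_eq2_countable) auto
qed

lemma finite_Int_config:
  assumes "point_process P" "X \<in> space P" "bounded B"
  shows "finite (X \<inter> B)"
proof -
  have "space P = space (config_space :: 'a set measure)"
    using assms(1) by (intro sets_eq_imp_space_eq) (simp add: point_process_def)
  also have "\<dots> = configurations"
    unfolding config_space_def by (rule space_measure_of) auto
  finally show ?thesis using assms by (auto simp: configurations_def)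
qed

lemma nn_integral_count_space_indicator_card:
  assumes "finite U" "U \<subseteq> A" "\<And>x. x \<in> A \<Longrightarrow> f x = indicator U x"
  shows "(\<integral>\<^sup>+x. f x \<partial>count_space A) = ennreal (real (card U))"
proof -
  have "(\<integral>\<^sup>+x. f x \<partial>count_space A) = (\<integral>\<^sup>+x. indicator U x \<partial>count_space A)"
    using assms(3) by (intro nn_integral_cong) auto
  also have "\<dots> = emeasure (count_space A) U" using assms(2) by (intro nn_integral_indicator) auto
  also have "\<dots> = ennreal (real (card U))"
    using assms(1,2) by (subst emeasure_count_space_finite) (auto simp: ennreal_of_nat_eq_real_of_nat)
  finally show ?thesis .
qed

lemma sum_distinct_1_tuples:
  assumes "finite (X \<inter> B)"
  shows "(\<integral>\<^sup>+x. indicator B (x 0) \<partial>count_space (distinct_tuples 1 X)) = ennreal (real (card (X \<inter> B)))"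
proof -
  have b: "bij_betw (\<lambda>p. (\<lambda>i\<in>{..<1::nat}. p)) (X \<inter> B) {x \<in> distinct_tuples 1 X. x 0 \<in> B}"
    by (rule bij_betw_byWitness[where f' = "\<lambda>x. x 0"])
      (auto simp: distinct_tuples_def fun_eq_iff PiE_iff extensional_def restrict_def inj_on_def)
  show ?thesis
    unfolding bij_betw_same_card[OF b]
    using bij_betw_finite[OF b] assms
    by (intro nn_integral_count_space_indicator_card) (auto simp: indicator_def)
qed

text \<open>The diagonal of \<open>(X \<inter> A) \<times> (X \<inter> B)\<close> is what ordered pairs of distinct points leave out.\<close>

lemma sum_distinct_2_tuples:
  assumes "finite (X \<inter> A)" "finite (X \<inter> B)"
  shows "(\<integral>\<^sup>+x. indicator A (x 0) * indicator B (x 1) \<partial>count_space (distinct_tuples 2 X))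
      + ennreal (real (card (X \<inter> (A \<inter> B)))) = ennreal (real (card (X \<inter> A)) * real (card (X \<inter> B)))"
proof -
  define V where "V = {p \<in> (X \<inter> A) \<times> (X \<inter> B). fst p \<noteq> snd p}"
  define g :: "'a \<times> 'a \<Rightarrow> nat \<Rightarrow> 'a" where "g p = (\<lambda>i\<in>{..<2}. if i = 0 then fst p else snd p)" for p
  have two: "{..<2 :: nat} = {0, 1}" by auto
  have mem: "x \<in> distinct_tuples 2 X \<longleftrightarrow> x 0 \<in> X \<and> x 1 \<in> X \<and> x 0 \<noteq> x 1 \<and> x \<in> extensional {..<2}" for x
    unfolding distinct_tuples_def two by (auto simp: PiE_def Pi_iff)
  have g: "g p 0 = fst p" "g p 1 = snd p" "g p \<in> extensional {..<2}" for p
    by (simp_all add: g_def)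
  have g_inv: "g (x 0, x 1) = x" if "x \<in> extensional {..<2}" for x
    by (rule extensionalityI[OF g(3) that]) (auto simp: g_def two)
  have b: "bij_betw g V {x \<in> distinct_tuples 2 X. x 0 \<in> A \<and> x 1 \<in> B}"
  proof (rule bij_betw_byWitness[where f' = "\<lambda>x. (x 0, x 1)"])
    show "\<forall>p\<in>V. (g p 0, g p 1) = p" by (simp add: g(1) g(2)[simplified])
    show "\<forall>x\<in>{x \<in> distinct_tuples 2 X. x 0 \<in> A \<and> x 1 \<in> B}. g (x 0, x 1) = x"
      using g_inv by (auto simp only: mem)
    show "g ` V \<subseteq> {x \<in> distinct_tuples 2 X. x 0 \<in> A \<and> x 1 \<in> B}"
      unfolding mem V_def using g by auto
    show "(\<lambda>x. (x 0, x 1)) ` {x \<in> distinct_tuples 2 X. x 0 \<in> A \<and> x 1 \<in> B} \<subseteq> V"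
      unfolding mem V_def by auto
  qed
  have "V \<subseteq> (X \<inter> A) \<times> (X \<inter> B)" unfolding V_def by blast
  then have fin: "finite V" using assms finite_subset by blast
  have I: "(\<integral>\<^sup>+x. indicator A (x 0) * indicator B (x 1) \<partial>count_space (distinct_tuples 2 X)) = ennreal (real (card V))"
    unfolding bij_betw_same_card[OF b]
    using bij_betw_finite[OF b] fin
    by (intro nn_integral_count_space_indicator_card) (auto simp: indicator_def)
  have "bij_betw (\<lambda>p. (p, p)) (X \<inter> (A \<inter> B)) {p \<in> (X \<inter> A) \<times> (X \<inter> B). fst p = snd p}"
    by (rule bij_betw_byWitness[where f' = fst]) auto
  then have d: "card (X \<inter> (A \<inter> B)) = card {p \<in> (X \<inter> A) \<times> (X \<inter> B). fst p = snd p}"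
    by (rule bij_betw_same_card)
  have "card V + card (X \<inter> (A \<inter> B)) = card ((X \<inter> A) \<times> (X \<inter> B))"
  proof -
    define E where "E = {p \<in> (X \<inter> A) \<times> (X \<inter> B). fst p = snd p}"
    have dE: "card (X \<inter> (A \<inter> B)) = card E" using d by (simp only: E_def)
    have VE: "(X \<inter> A) \<times> (X \<inter> B) = V \<union> E" "V \<inter> E = {}" by (auto simp: V_def E_def)
    have "finite E"
      using finite_subset[of E "(X \<inter> A) \<times> (X \<inter> B)"] assms VE by blast
    then show ?thesis
      unfolding dE VE(1) using fin VE(2) by (intro card_Un_disjoint[symmetric])
  qed
  then have "real (card V) + real (card (X \<inter> (A \<inter> B))) = real (card (X \<inter> A)) * real (card (X \<inter> B))"
    by (simp add: card_cartesian_product flip: of_nat_add of_nat_mult)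
  then show ?thesis unfolding I by (simp flip: ennreal_plus)
qed

lemma expectation_card:
  fixes P :: "'a::euclidean_space set measure"
  assumes P: "determinantal_process P K" and K: "\<And>x. K x x = 1"
    and B [measurable]: "B \<in> sets borel" and bB: "bounded B"
  shows "(\<integral>\<^sup>+X. ennreal (real (card (X \<inter> B))) \<partial>P) = emeasure lborel B"
proof -
  interpret product_sigma_finite "\<lambda>_ :: nat. lborel :: 'a measure" by standard
  define \<rho> where "\<rho> x = Determinant.det (Matrix.mat 1 1 (\<lambda>(i, j). K (x i) (x j)))" for x :: "nat \<Rightarrow> 'a"
  have pp: "point_process P" and c: "is_correlation_function P 1 \<rho>"
    using P by (auto simp: determinantal_process_def \<rho>_def[abs_def])
  have one: "{..<1 :: nat} = {0}" by auto
  have \<rho>: "\<rho> x = 1" for x unfolding \<rho>_def det_mat_1 by (simp add: K)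
  have f: "(\<lambda>x. indicator B (x 0) :: ennreal) \<in> borel_measurable (PiM {..<1 :: nat} (\<lambda>_. lborel :: 'a measure))"
    unfolding one by measurable
  have "(\<integral>\<^sup>+X. ennreal (real (card (X \<inter> B))) \<partial>P)
      = (\<integral>\<^sup>+X. (\<integral>\<^sup>+x. indicator B (x 0) \<partial>count_space (distinct_tuples 1 X)) \<partial>P)"
    by (intro nn_integral_cong sum_distinct_1_tuples[symmetric] finite_Int_config[OF pp _ bB])
  also have "\<dots> = (\<integral>\<^sup>+x. indicator B (x 0) * ennreal (\<rho> x) \<partial>PiM {..<1 :: nat} (\<lambda>_. lborel :: 'a measure))"
    using c f unfolding is_correlation_function_def by blast
  also have "\<dots> = (\<integral>\<^sup>+x. indicator B (x 0) \<partial>PiM {0 :: nat} (\<lambda>_. lborel :: 'a measure))"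
    by (simp only: \<rho> one ennreal_1 mult_1_right)
  also have "\<dots> = emeasure lborel B"
    by (subst product_nn_integral_singleton) auto
  finally show ?thesis .
qed

text \<open>The two-point correlation function is \<open>1 - (K x y)\<^sup>2\<close>. The negative term is moved to the left
  so that all integrals are nonnegative.\<close>

lemma expectation_card_mult:
  fixes P :: "'a::euclidean_space set measure"
  assumes P: "determinantal_process P K" and K: "\<And>x. K x x = 1" and sym: "\<And>x y. K x y = K y x"
    and le_1: "\<And>x y. (K x y)\<^sup>2 \<le> 1"
    and mK [measurable]: "(\<lambda>(x, y). K x y) \<in> borel_measurable (borel \<Otimes>\<^sub>M borel)"
    and A [measurable]: "A \<in> sets borel" and bA: "bounded A" and B [measurable]: "B \<in> sets borel" and bB: "bounded B"
  shows "(\<integral>\<^sup>+X. ennreal (real (card (X \<inter> A)) * real (card (X \<inter> B))) \<partial>P)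
      + (\<integral>\<^sup>+x. (\<integral>\<^sup>+y. indicator A x * indicator B y * ennreal ((K x y)\<^sup>2) \<partial>lborel) \<partial>lborel)
      = emeasure lborel (A \<inter> B) + emeasure lborel A * emeasure lborel B"
proof -
  interpret product_sigma_finite "\<lambda>_ :: nat. lborel :: 'a measure" by standard
  define \<rho> where "\<rho> x = Determinant.det (Matrix.mat 2 2 (\<lambda>(i, j). K (x i) (x j)))" for x :: "nat \<Rightarrow> 'a"
  have pp: "point_process P" and c: "is_correlation_function P 2 \<rho>"
    using P by (auto simp: determinantal_process_def \<rho>_def[abs_def])
  have two: "{..<2 :: nat} = {0, 1}" by auto
  have \<rho>: "\<rho> x = 1 - (K (x 0) (x 1))\<^sup>2" for x
    unfolding \<rho>_def det_mat_2 by (simp add: K sym[of "x (Suc 0)" "x 0"] power2_eq_square)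
  define f :: "(nat \<Rightarrow> 'a) \<Rightarrow> ennreal" where "f x = indicator A (x 0) * indicator B (x 1)" for x
  have f: "f \<in> borel_measurable (PiM {..<2 :: nat} (\<lambda>_. lborel :: 'a measure))"
    unfolding two f_def by measurable
  define J where "J = (\<integral>\<^sup>+X. (\<integral>\<^sup>+x. f x \<partial>count_space (distinct_tuples 2 X)) \<partial>P)"
  have prodJ: "(\<integral>\<^sup>+X. ennreal (real (card (X \<inter> A)) * real (card (X \<inter> B))) \<partial>P) = J + emeasure lborel (A \<inter> B)"
  proof -
    have AB: "A \<inter> B \<in> sets borel" "bounded (A \<inter> B)" using bA by (auto intro: bounded_Int)
    have [measurable]: "(\<lambda>X. card (X \<inter> A)) \<in> measurable P (count_space UNIV)"
        "(\<lambda>X. card (X \<inter> B)) \<in> measurable P (count_space UNIV)"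
        "(\<lambda>X. card (X \<inter> (A \<inter> B))) \<in> measurable P (count_space UNIV)"
      by (intro measurable_card_Int[OF pp] A B bA bB AB)+
    have split: "(\<integral>\<^sup>+x. f x \<partial>count_space (distinct_tuples 2 X)) + ennreal (real (card (X \<inter> (A \<inter> B))))
       = ennreal (real (card (X \<inter> A)) * real (card (X \<inter> B)))" if "X \<in> space P" for X
      unfolding f_def using finite_Int_config[OF pp that] bA bB by (intro sum_distinct_2_tuples) auto
    (* The sum over pairs is measurable in X because it is a difference of functions of counts. *)
    have "(\<integral>\<^sup>+x. f x \<partial>count_space (distinct_tuples 2 X))
       = ennreal (real (card (X \<inter> A)) * real (card (X \<inter> B))) - ennreal (real (card (X \<inter> (A \<inter> B))))"
      if "X \<in> space P" for X
      using split[OF that] by (metis ennreal_add_diff_cancel_right ennreal_neq_top)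
    then have [measurable]: "(\<lambda>X. \<integral>\<^sup>+x. f x \<partial>count_space (distinct_tuples 2 X)) \<in> borel_measurable P"
      by (subst measurable_cong) auto
    have "(\<integral>\<^sup>+X. ennreal (real (card (X \<inter> A)) * real (card (X \<inter> B))) \<partial>P)
        = (\<integral>\<^sup>+X. (\<integral>\<^sup>+x. f x \<partial>count_space (distinct_tuples 2 X)) + ennreal (real (card (X \<inter> (A \<inter> B)))) \<partial>P)"
      by (intro nn_integral_cong split[symmetric])
    also have "\<dots> = J + emeasure lborel (A \<inter> B)"
      unfolding J_def by (subst nn_integral_add) (auto simp: expectation_card[OF P K AB])
    finally show ?thesis .
  qed
  have "J = (\<integral>\<^sup>+x. f x * ennreal (\<rho> x) \<partial>PiM {..<2 :: nat} (\<lambda>_. lborel :: 'a measure))"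
    unfolding J_def using c f unfolding is_correlation_function_def by blast
  also have "\<dots> = (\<integral>\<^sup>+x. indicator A (x 0) * indicator B (x 1) * ennreal (1 - (K (x 0) (x 1))\<^sup>2) \<partial>PiM {0, 1 :: nat} (\<lambda>_. lborel))"
    by (simp only: f_def \<rho> two)
  also have "\<dots> = (\<integral>\<^sup>+z. indicator A (fst z) * indicator B (snd z) * ennreal (1 - (K (fst z) (snd z))\<^sup>2) \<partial>(lborel \<Otimes>\<^sub>M lborel))"
    by (subst product_nn_integral_pair[where f = "\<lambda>x y. indicator A x * indicator B y * ennreal (1 - (K x y)\<^sup>2)"]) auto
  also have "\<dots> = (\<integral>\<^sup>+x. (\<integral>\<^sup>+y. indicator A x * indicator B y * ennreal (1 - (K x y)\<^sup>2) \<partial>lborel) \<partial>lborel)"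
    by (subst lborel.nn_integral_fst[symmetric]) auto
  finally have "J + (\<integral>\<^sup>+x. (\<integral>\<^sup>+y. indicator A x * indicator B y * ennreal ((K x y)\<^sup>2) \<partial>lborel) \<partial>lborel)
     = (\<integral>\<^sup>+x. (\<integral>\<^sup>+y. indicator A x * indicator B y * ennreal (1 - (K x y)\<^sup>2)
                  + indicator A x * indicator B y * ennreal ((K x y)\<^sup>2) \<partial>lborel) \<partial>lborel)"
    by (simp add: nn_integral_add)
  also have "\<dots> = (\<integral>\<^sup>+x. (\<integral>\<^sup>+y. indicator A x * indicator B y \<partial>lborel) \<partial>lborel)"
    using le_1 by (intro nn_integral_cong) (auto simp: distrib_left[symmetric] ennreal_plus[symmetric] simp del: ennreal_plus)
  also have "\<dots> = emeasure lborel A * emeasure lborel B"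
    by (simp add: nn_integral_cmult nn_integral_multc)
  finally show ?thesis unfolding prodJ by (simp add: add_ac)
qed

section \<open>The variance as a Dirichlet form\<close>

text \<open>Expand the square: each row sum of \<open>a\<close> is the total rate of jumps out of a site, and a row sum
  below one only makes the right-hand side larger (it would be a killing term).\<close>

lemma dirichlet_form_le:
  fixes a :: "'i \<Rightarrow> 'i \<Rightarrow> real" and c :: "'i \<Rightarrow> real"
  assumes sym: "\<And>n m. a n m = a m n" and row: "\<And>n. (\<Sum>m\<in>F. a n m) \<le> 1"
  shows "(\<Sum>n\<in>F. \<Sum>m\<in>F. a n m * (c n - c m)\<^sup>2) / 2 \<le> (\<Sum>n\<in>F. (c n)\<^sup>2) - (\<Sum>n\<in>F. \<Sum>m\<in>F. a n m * (c n * c m))"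
proof -
  have swap: "(\<Sum>n\<in>F. \<Sum>m\<in>F. a n m * (c m)\<^sup>2) = (\<Sum>n\<in>F. \<Sum>m\<in>F. a n m * (c n)\<^sup>2)"
    by (subst sum.swap) (simp add: sym)
  have "(\<Sum>n\<in>F. \<Sum>m\<in>F. a n m * (c n - c m)\<^sup>2)
      = (\<Sum>n\<in>F. \<Sum>m\<in>F. a n m * (c n)\<^sup>2 + a n m * (c m)\<^sup>2 - 2 * (a n m * (c n * c m)))"
    by (intro sum.cong refl) (simp add: power2_diff algebra_simps)
  also have "\<dots> = 2 * (\<Sum>n\<in>F. \<Sum>m\<in>F. a n m * (c n)\<^sup>2) - 2 * (\<Sum>n\<in>F. \<Sum>m\<in>F. a n m * (c n * c m))"
    by (simp add: sum.distrib sum_subtractf swap flip: sum_distrib_left)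
  also have "(\<Sum>n\<in>F. \<Sum>m\<in>F. a n m * (c n)\<^sup>2) \<le> (\<Sum>n\<in>F. (c n)\<^sup>2)"
  proof (rule sum_mono)
    fix n
    have "(\<Sum>m\<in>F. a n m) * (c n)\<^sup>2 \<le> 1 * (c n)\<^sup>2" by (intro mult_right_mono row) auto
    then show "(\<Sum>m\<in>F. a n m * (c n)\<^sup>2) \<le> (c n)\<^sup>2" by (simp add: sum_distrib_right)
  qed
  finally show ?thesis by simp
qed

lemma count_process_moment:
  assumes P: "determinantal_process P K_S"
  shows "integrable P (\<lambda>X. count_process 1 n X * count_process 1 m X)"
    and "(\<integral>X. count_process 1 n X * count_process 1 m X \<partial>P) = (if n = m then 1 else 0) + 1 - overlap n m"
proof -
  define I where "I = (\<integral>\<^sup>+X. ennreal (count_process 1 n X * count_process 1 m X) \<partial>P)"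
  define r :: real where "r = (if n = m then 1 else 0) + 1"
  have int: "emeasure lborel (box_at 1 n \<inter> box_at 1 m) = ennreal (if n = m then 1 else 0)"
  proof (cases "n = m")
    case False
    then have "box_at 1 n \<inter> box_at 1 m = {}" using box_at_disjoint by blast
    with False show ?thesis by simp
  qed (simp add: emeasure_box_at)
  have pp: "point_process P" using P by (simp add: determinantal_process_def)
  have [measurable]: "(\<lambda>X. card (X \<inter> box_at 1 k)) \<in> measurable P (count_space UNIV)" for k :: "int ^ 2"
    by (intro measurable_card_Int[OF pp] box_at_borel bounded_box_at)
  have meas: "(\<lambda>X. count_process 1 n X * count_process 1 m X) \<in> borel_measurable P"
    unfolding count_process_def by measurable
  have "I + ennreal (overlap n m) = ennreal (if n = m then 1 else 0) + 1"
    using expectation_card_mult[OF P K_S_diag K_S_sym K_S_sq_le_1 measurable_K_S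
        box_at_borel[of 1 n] bounded_box_at box_at_borel[of 1 m] bounded_box_at]
    by (simp only: I_def count_process_def kernel_mass_def[symmetric] kernel_mass_eq_overlap int emeasure_box_at) simp
  then have sum: "I + ennreal (overlap n m) = ennreal r"
    unfolding r_def by (simp add: ennreal_plus)
  have "I = (I + ennreal (overlap n m)) - ennreal (overlap n m)" by simp
  also have "\<dots> = ennreal (r - overlap n m)" unfolding sum by (simp add: ennreal_minus overlap_nonneg)
  finally have I: "I = ennreal (r - overlap n m)" .
  have nn: "0 \<le> r - overlap n m"
    using sum_overlap_le[of "{m}" n] by (auto simp: r_def)
  show "integrable P (\<lambda>X. count_process 1 n X * count_process 1 m X)"
    by (rule integrableI_nonneg[OF meas]) (use I in \<open>auto simp: I_def count_process_def\<close>)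
  have "(\<integral>X. count_process 1 n X * count_process 1 m X \<partial>P) = enn2real I"
    unfolding I_def by (rule integral_eq_nn_integral[OF meas]) (simp add: count_process_def)
  also have "\<dots> = (if n = m then 1 else 0) + 1 - overlap n m" using nn by (simp add: I r_def)
  finally show "(\<integral>X. count_process 1 n X * count_process 1 m X \<partial>P) = (if n = m then 1 else 0) + 1 - overlap n m" .
qed

text \<open>The covariance of two counts is the Kronecker delta minus the overlap, so the variance of a linear combination
  is the right-hand side of \<open>dirichlet_form_le\<close>; the squared mean is discarded.\<close>

lemma second_moment_ge_dirichlet_form:
  assumes P: "determinantal_process P K_S" and F: "finite F"
  shows "ennreal ((\<Sum>n\<in>F. \<Sum>m\<in>F. overlap n m * (c n - c m)\<^sup>2) / 2)
    \<le> (\<integral>\<^sup>+X. ennreal ((\<Sum>n\<in>F. c n * count_process 1 n X)\<^sup>2) \<partial>P)"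
proof -
  have sq: "(\<Sum>n\<in>F. c n * count_process 1 n X)\<^sup>2
      = (\<Sum>n\<in>F. \<Sum>m\<in>F. c n * c m * (count_process 1 n X * count_process 1 m X))" for X
    by (simp add: power2_eq_square sum_product mult_ac)
  have "(\<Sum>n\<in>F. \<Sum>m\<in>F. overlap n m * (c n - c m)\<^sup>2) / 2
      \<le> (\<Sum>n\<in>F. (c n)\<^sup>2) - (\<Sum>n\<in>F. \<Sum>m\<in>F. overlap n m * (c n * c m))"
    by (intro dirichlet_form_le overlap_sym sum_overlap_le F)
  also have "\<dots> \<le> (\<Sum>n\<in>F. (c n)\<^sup>2) - (\<Sum>n\<in>F. \<Sum>m\<in>F. overlap n m * (c n * c m)) + (\<Sum>n\<in>F. c n)\<^sup>2"
    by simp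
  also have "\<dots> = (\<Sum>n\<in>F. \<Sum>m\<in>F. c n * c m * ((if n = m then 1 else 0) + 1 - overlap n m))"
  proof -
    have "(\<Sum>n\<in>F. \<Sum>m\<in>F. c n * c m * ((if n = m then 1 else 0) + 1 - overlap n m))
       = (\<Sum>n\<in>F. \<Sum>m\<in>F. (if n = m then c n * c m else 0) + c n * c m - overlap n m * (c n * c m))"
      by (intro sum.cong refl) (simp add: algebra_simps)
    also have "\<dots> = (\<Sum>n\<in>F. c n * c n) + (\<Sum>n\<in>F. c n) * (\<Sum>m\<in>F. c m) - (\<Sum>n\<in>F. \<Sum>m\<in>F. overlap n m * (c n * c m))"
      using F by (simp add: sum.distrib sum_subtractf sum_product)
    finally show ?thesis by (simp add: power2_eq_square)
  qed
  also have "\<dots> = (\<integral>X. (\<Sum>n\<in>F. c n * count_process 1 n X)\<^sup>2 \<partial>P)"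
    unfolding sq by (simp add: count_process_moment[OF P])
  finally have "ennreal ((\<Sum>n\<in>F. \<Sum>m\<in>F. overlap n m * (c n - c m)\<^sup>2) / 2)
      \<le> ennreal (\<integral>X. (\<Sum>n\<in>F. c n * count_process 1 n X)\<^sup>2 \<partial>P)" by (rule ennreal_leI)
  also have "\<dots> = (\<integral>\<^sup>+X. ennreal ((\<Sum>n\<in>F. c n * count_process 1 n X)\<^sup>2) \<partial>P)"
  proof (rule nn_integral_eq_integral[symmetric])
    show "integrable P (\<lambda>X. (\<Sum>n\<in>F. c n * count_process 1 n X)\<^sup>2)"
      unfolding sq by (intro Bochner_Integration.integrable_sum integrable_mult_right count_process_moment[OF P])
  qed simp
  finally show ?thesis .
qed

text \<open>This is the quantitative form of the failure of rigidity: the distance of \<open>count_process 1 0\<close> from the span of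
  the other counts is at least \<open>1 / sqrt (131072 * pi ^ 4)\<close>. Extended by zero, the coefficients allow
  \<open>F\<close> to be enlarged to contain any finite set of lattice points without changing the combination; this
  yields the bound on the Dirichlet form over every finite set. The constant is
  \<open>131072 = 1024 * 128\<close>, with \<open>1024\<close> from the lower bound of the overlaps and
  \<open>128 = 8\<^sup>2 * 2\<close> from the capacity estimate and the factor \<open>1 / 2\<close> of the Dirichlet form.\<close>

lemma second_moment_ge_coefficient:
  assumes P: "determinantal_process P K_S" and F: "finite F" "0 \<in> F"
  shows "ennreal ((c 0)\<^sup>2 / (131072 * pi ^ 4)) \<le> (\<integral>\<^sup>+X. ennreal ((\<Sum>n\<in>F. c n * count_process 1 n X)\<^sup>2) \<partial>P)"
proof (cases "(\<integral>\<^sup>+X. ennreal ((\<Sum>n\<in>F. c n * count_process 1 n X)\<^sup>2) \<partial>P)" rule: ennreal_cases)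
  case top
  then show ?thesis by simp
next
  case (real Q)
  define d where "d n = (if n \<in> F then c n else 0)" for n
  define \<kappa> where "\<kappa> = 1 / (1024 * pi ^ 4)"
  have \<kappa>: "0 < \<kappa>" by (simp add: \<kappa>_def)
  have "\<bar>(d \<circ> lattice_point) (0, 0)\<bar> \<le> 8 * sqrt (2 * Q / \<kappa>)"
  proof (rule value_at_origin_le_dirichlet_form)
    have "finite (lattice_point -` F)" by (rule finite_vimageI[OF F(1) inj_lattice_point])
    then show "finite {p. (d \<circ> lattice_point) p \<noteq> 0}"
      by (rule rev_finite_subset) (auto simp: d_def split: if_splits)
  next
    fix G :: "(int \<times> int) set" assume G: "finite G"
    define H where "H = F \<union> lattice_point ` G"
    have H: "finite H" using F G by (simp add: H_def)
    have sum_H: "(\<Sum>n\<in>H. d n * count_process 1 n X) = (\<Sum>n\<in>F. c n * count_process 1 n X)" for X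
      by (rule sum.mono_neutral_cong_right) (use H in \<open>auto simp: H_def d_def\<close>)
    have "\<kappa> * (\<Sum>p\<in>G. \<Sum>q\<in>G. jump_weight p q * ((d \<circ> lattice_point) p - (d \<circ> lattice_point) q)\<^sup>2)
        \<le> (\<Sum>p\<in>G. \<Sum>q\<in>G. overlap (lattice_point p) (lattice_point q) * (d (lattice_point p) - d (lattice_point q))\<^sup>2)"
      unfolding sum_distrib_left
    proof (intro sum_mono)
      fix p q
      have "\<kappa> * jump_weight p q \<le> overlap (lattice_point p) (lattice_point q)"
        using overlap_ge_jump_weight[of p q] by (simp add: \<kappa>_def)
      from mult_right_mono[OF this, of "(d (lattice_point p) - d (lattice_point q))\<^sup>2"]
      show "\<kappa> * (jump_weight p q * ((d \<circ> lattice_point) p - (d \<circ> lattice_point) q)\<^sup>2)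
        \<le> overlap (lattice_point p) (lattice_point q) * (d (lattice_point p) - d (lattice_point q))\<^sup>2"
        by (simp add: mult.assoc)
    qed
    also have "\<dots> = (\<Sum>n\<in>lattice_point ` G. \<Sum>m\<in>lattice_point ` G. overlap n m * (d n - d m)\<^sup>2)"
      by (simp add: sum.reindex[OF inj_on_subset[OF inj_lattice_point]])
    also have "\<dots> \<le> (\<Sum>n\<in>H. \<Sum>m\<in>lattice_point ` G. overlap n m * (d n - d m)\<^sup>2)"
      by (rule sum_mono2[OF H]) (auto simp: H_def overlap_nonneg intro!: sum_nonneg)
    also have "\<dots> \<le> (\<Sum>n\<in>H. \<Sum>m\<in>H. overlap n m * (d n - d m)\<^sup>2)"
      by (intro sum_mono sum_mono2[OF H]) (auto simp: H_def overlap_nonneg)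
    also have "\<dots> \<le> 2 * Q"
    proof -
      have "ennreal ((\<Sum>n\<in>H. \<Sum>m\<in>H. overlap n m * (d n - d m)\<^sup>2) / 2) \<le> ennreal Q"
        using second_moment_ge_dirichlet_form[OF P H, of d] by (simp only: sum_H real)
      then show ?thesis using \<open>0 \<le> Q\<close> by simp
    qed
    finally show "(\<Sum>p\<in>G. \<Sum>q\<in>G. jump_weight p q * ((d \<circ> lattice_point) p - (d \<circ> lattice_point) q)\<^sup>2) \<le> 2 * Q / \<kappa>"
      using \<kappa> by (simp add: field_simps)
  qed
  moreover have "lattice_point (0, 0) = 0" by (simp add: lattice_point_def Finite_Cartesian_Product.vec_eq_iff)
  ultimately have "\<bar>c 0\<bar> \<le> 8 * sqrt (2 * Q / \<kappa>)" using F(2) by (simp add: d_def)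
  then have "\<bar>c 0\<bar>\<^sup>2 \<le> (8 * sqrt (2 * Q / \<kappa>))\<^sup>2" by (rule power_mono) simp
  also have "\<dots> = 128 * Q / \<kappa>" using \<kappa> \<open>0 \<le> Q\<close> by (simp add: power_mult_distrib)
  finally have "(c 0)\<^sup>2 / (131072 * pi ^ 4) \<le> Q" by (simp add: \<kappa>_def field_simps)
  then show ?thesis unfolding real by (rule ennreal_leI)
qed

section \<open>Failure of linear rigidity\<close>

lemma linear_span_indexed:
  assumes "g \<in> linear_span {N n | n. n \<noteq> k}"
  obtains F c where "finite F" "k \<notin> F" "g = (\<lambda>w. \<Sum>n\<in>F. c n * N n w)"
proof -
  obtain T b where T: "finite T" "T \<subseteq> {N n | n. n \<noteq> k}" and g: "g = (\<lambda>w. \<Sum>h\<in>T. b h * h w)"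
    using assms unfolding linear_span_def by blast
  then have "\<forall>h\<in>T. \<exists>n. n \<noteq> k \<and> h = N n" by blast
  then obtain i where i: "\<And>h. h \<in> T \<Longrightarrow> i h \<noteq> k" "\<And>h. h \<in> T \<Longrightarrow> N (i h) = h"
    by (metis bchoice)
  have "inj_on i T" by (rule inj_on_inverseI[where g = N]) (rule i)
  then have "g = (\<lambda>w. \<Sum>n\<in>i ` T. b (N n) * N n w)"
    by (simp add: g sum.reindex i)
  with i T show thesis by (intro that[of "i ` T" "\<lambda>n. b (N n)"]) auto
qed

theorem proposition4p4:
  fixes P :: "(real ^ 2) set measure"
  assumes "determinantal_process P K_S"
  shows "\<not> linearly_rigid P \<and> count_process 1 0 \<notin> H_check_0 P (count_process 1)"
proof -
  have main: "(count_process 1 0 :: (real ^ 2) set \<Rightarrow> real) \<notin> H_check_0 P (count_process 1)"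
  proof
    assume "(count_process 1 0 :: (real ^ 2) set \<Rightarrow> real) \<in> H_check_0 P (count_process 1)"
    moreover define \<epsilon> where "\<epsilon> = sqrt (1 / (131072 * pi ^ 4))"
    moreover have "0 < \<epsilon>" by (simp add: \<epsilon>_def)
    ultimately obtain g where g: "g \<in> linear_span {count_process 1 n | n :: int ^ 2. n \<noteq> 0}"
      and less: "(\<integral>\<^sup>+X. ennreal ((count_process 1 (0 :: int ^ 2) X - g X)\<^sup>2) \<partial>P) < ennreal (\<epsilon>\<^sup>2)"
      unfolding H_check_0_def L2_closed_linear_span_def by blast
    from g obtain F c where F: "finite F" "0 \<notin> F" and g_eq: "g = (\<lambda>X. \<Sum>n\<in>F. c n * count_process 1 n X)"
      by (rule linear_span_indexed)
    define d where "d n = (if n = 0 then 1 else - c n)" for n :: "int ^ 2"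
    have eq: "count_process 1 0 X - g X = (\<Sum>n\<in>insert 0 F. d n * count_process 1 n X)" for X
    proof -
      have "(\<Sum>n\<in>F. d n * count_process 1 n X) = (\<Sum>n\<in>F. - (c n * count_process 1 n X))"
        using F by (intro sum.cong) (auto simp: d_def)
      then show ?thesis using F by (simp add: g_eq d_def sum_negf)
    qed
    have "ennreal ((d 0)\<^sup>2 / (131072 * pi ^ 4)) \<le> (\<integral>\<^sup>+X. ennreal ((\<Sum>n\<in>insert 0 F. d n * count_process 1 n X)\<^sup>2) \<partial>P)"
      using F by (intro second_moment_ge_coefficient[OF assms]) auto
    moreover have "(d 0)\<^sup>2 / (131072 * pi ^ 4) = \<epsilon>\<^sup>2" by (simp add: d_def \<epsilon>_def)
    ultimately have "ennreal (\<epsilon>\<^sup>2) \<le> (\<integral>\<^sup>+X. ennreal ((count_process 1 (0 :: int ^ 2) X - g X)\<^sup>2) \<partial>P)"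
      by (simp only: eq)
    from leD[OF this] less show False by contradiction
  qed
  have "\<not> linearly_rigid P"
  proof
    assume "linearly_rigid P"
    then have "(0 :: real) < 1 \<longrightarrow> (count_process 1 0 :: (real ^ 2) set \<Rightarrow> real) \<in> H_check_0 P (count_process 1)"
      unfolding linearly_rigid_def by (rule spec)
    moreover have "(0 :: real) < 1" by simp
    ultimately have "(count_process 1 0 :: (real ^ 2) set \<Rightarrow> real) \<in> H_check_0 P (count_process 1)"
      by (rule mp)
    with main show False by contradiction
  qed
  from this main show ?thesis by (rule conjI)
qed

end
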